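(* For a complex parameter $\mu\in\mathbb{C}$ and $z=x+iy$ define $$W_\mu=(|z|^2+24)z^2-2\mu\bar z,\qquad T_\mu=z^3+\mu,$$ $$S_\mu=|T_\mu|^2+36|z|^4+576|z|^2+2304,\qquad Q_\mu=|W_\mu|^2+16S_\mu,\qquad \widetilde\Psi_{2,\mu}=\frac{W_\mu}{\sqrt{Q_\mu}} .$$ Then: (i) writing $(\widetilde\Psi_{2,\mu})^2=g/f$ with $f=Q_\mu$, $g=W_\mu^2$, and setting $h=192z(z^3+4\mu)$, one has $$D^2f\cdot f=512S_\mu^2=2(f-|g|)^2,\qquad D^2g\cdot g=2gh,\qquad D^2g\cdot f=-16S_\mu(g+h);$$ (ii) $\widetilde\Psi_{2,\mu}$ is a solution, with the $(1,3)$-configuration, of the complex sine-Gordon II equation on $\mathbb{R}^2$ $$\Delta\psi+\frac{(\nabla\psi)^2\bar\psi}{2-|\psi|^2}+\frac12\psi(1-|\psi|^2)(2-|\psi|^2)=0;$$ (iii) if $\mu=\alpha(\alpha^2+12)(1-i)$ with $\alpha\ge0$, then $W_\mu=N_{1,\alpha}+iN_{2,\alpha}$ and $Q_\mu=P_\alpha$, so that $\widetilde\Psi_{2,\mu}=\Psi_{2,\alpha}:=(N_{1,\alpha}+iN_{2,\alpha})/\sqrt{P_\alpha}$, where $$N_{1,\alpha}=\big(r^2+24+\alpha(x+y)+2\alpha^2\big)R_\alpha+\alpha(-x+y)I_\alpha,\qquad N_{2,\alpha}=\alpha(-x+y)R_\alpha+\big(r^2+24-\alpha(x+y)+2\alpha^2\big)I_\alpha,$$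 $R_\alpha=x^2-y^2-\alpha x+\alpha y$, $I_\alpha=2xy+\alpha x+\alpha y$, $r^2=x^2+y^2$, and $$\begin{aligned}P_\alpha={}&r^8+64r^6+1152r^4+9216r^2+36864\\&+\alpha\big(-48x^5+144x^4y+96x^3y^2-768x^3+96x^2y^3+2304x^2y+144xy^4+2304xy^2-48y^5-768y^3\big)\\&+\alpha^2\big(1152r^2+4608\big)\\&+\alpha^3\big(-4x^5+12x^4y+8x^3y^2-64x^3+8x^2y^3+192x^2y+12xy^4+192xy^2-4y^5-64y^3\big)\\&+\alpha^4\big(192r^2+768\big)+\alpha^6\big(8r^2+32\big).\end{aligned}$$ Thus the family $\Psi_{2,\alpha}$ with real parameter $\alpha$ extends to a family of solutions with an arbitrary complex parameter.
   Context: For complex-valued functions $f,g$ on $\mathbb{R}^2$, the Hirota bilinear operator is $D^2f\cdot g=(\Delta f)g-2\nabla f\cdot\nabla g+f\Delta g$, where $\nabla f\cdot\nabla g=f_xg_x+f_yg_y$ (no complex conjugation). Here $\psi:\mathbb{R}^2\to\mathbb{C}$ and $(\nabla\psi)^2=(\partial_x\psi)^2+(\partial_y\psi)^2$. The "$(1,3)$-configuration" refers to the equilateral triangular vortex configuration: the vortex points (zeros) are a central point, the origin, together with the three vertices of an equilateral triangle centered at it. For $\Psi_{2,\alpha}$ these are $0$, $\sqrt2\alpha e^{-3\pi i/4}$, $\sqrt2\alpha e^{-\pi i/12}$, $\sqrt2\alpha e^{7\pi i/12}$. *)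

theory Defs
  imports "HOL-Analysis.Analysis"
begin

section \<open>Differential operators on the plane\<close>

text \<open>
  The plane is \<^typ>\<open>real \<times> real\<close>. The library operator \<^const>\<open>frechet_derivative\<close> has an
  unspecified value where a function is not differentiable, so differentiability is demanded
  explicitly in the notion of solution below.
\<close>

definition partial_x :: "(real \<times> real \<Rightarrow> complex) \<Rightarrow> real \<times> real \<Rightarrow> complex" where
  "partial_x f p = frechet_derivative f (at p) (1, 0)"

definition partial_y :: "(real \<times> real \<Rightarrow> complex) \<Rightarrow> real \<times> real \<Rightarrow> complex" where
  "partial_y f p = frechet_derivative f (at p) (0, 1)"

definition laplacian :: "(real \<times> real \<Rightarrow> complex) \<Rightarrow> real \<times> real \<Rightarrow> complex" where
  "laplacian f p = partial_x (partial_x f) p + partial_y (partial_y f) p"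

text \<open>Complex bilinear, without conjugation: \<open>grad_dot f f\<close> is \<open>(\<nabla>f)\<^sup>2\<close>.\<close>

definition grad_dot ::
  "(real \<times> real \<Rightarrow> complex) \<Rightarrow> (real \<times> real \<Rightarrow> complex) \<Rightarrow> real \<times> real \<Rightarrow> complex" where
  "grad_dot f g p = partial_x f p * partial_x g p + partial_y f p * partial_y g p"

definition hirota_D2 ::
  "(real \<times> real \<Rightarrow> complex) \<Rightarrow> (real \<times> real \<Rightarrow> complex) \<Rightarrow> real \<times> real \<Rightarrow> complex" where
  "hirota_D2 f g p = laplacian f p * g p - 2 * grad_dot f g p + f p * laplacian g p"

definition C2_on_plane :: "(real \<times> real \<Rightarrow> complex) \<Rightarrow> bool" where
  "C2_on_plane f \<longleftrightarrow>
     f differentiable_on UNIV \<and>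
     partial_x f differentiable_on UNIV \<and> partial_y f differentiable_on UNIV \<and>
     continuous_on UNIV (partial_x (partial_x f)) \<and>
     continuous_on UNIV (partial_y (partial_x f)) \<and>
     continuous_on UNIV (partial_x (partial_y f)) \<and>
     continuous_on UNIV (partial_y (partial_y f))"

section \<open>The complex sine-Gordon II equation\<close>

text \<open>Classical solutions on the whole plane; the second conjunct makes the quotient meaningful.\<close>

definition csG2_solution :: "(real \<times> real \<Rightarrow> complex) \<Rightarrow> bool" where
  "csG2_solution \<psi> \<longleftrightarrow>
     C2_on_plane \<psi> \<and>
     (\<forall>p. (cmod (\<psi> p))\<^sup>2 \<noteq> 2) \<and>
     (\<forall>p. laplacian \<psi> p
          + grad_dot \<psi> \<psi> p * cnj (\<psi> p) / (2 - complex_of_real ((cmod (\<psi> p))\<^sup>2))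
          + 1 / 2 * \<psi> p * (1 - complex_of_real ((cmod (\<psi> p))\<^sup>2))
              * (2 - complex_of_real ((cmod (\<psi> p))\<^sup>2)) = 0)"

section \<open>Vortex configurations\<close>

definition vortex_points :: "(real \<times> real \<Rightarrow> complex) \<Rightarrow> (real \<times> real) set" where
  "vortex_points \<psi> = {p. \<psi> p = 0}"

text \<open>
  The triangle is nondegenerate. In the family below the three vertices merge with the origin
  exactly when \<open>\<mu> = 0\<close>, so that value needs separate treatment.
\<close>

definition centered_equilateral_triangle ::
  "real \<times> real \<Rightarrow> real \<times> real \<Rightarrow> real \<times> real \<Rightarrow> bool" where
  "centered_equilateral_triangle a b c \<longleftrightarrow>
     a \<noteq> b \<and> dist a b = dist b c \<and> dist b c = dist c a \<and> (1 / 3) *\<^sub>R (a + b + c) = 0"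

definition one_three_configuration :: "(real \<times> real \<Rightarrow> complex) \<Rightarrow> bool" where
  "one_three_configuration \<psi> \<longleftrightarrow>
     (\<exists>a b c. centered_equilateral_triangle a b c \<and> vortex_points \<psi> = {0, a, b, c})"

section \<open>The family with a complex parameter\<close>

definition zc :: "real \<times> real \<Rightarrow> complex" where
  "zc p = Complex (fst p) (snd p)"

definition W :: "complex \<Rightarrow> real \<times> real \<Rightarrow> complex" where
  "W \<mu> p = (complex_of_real ((cmod (zc p))\<^sup>2) + 24) * (zc p)\<^sup>2 - 2 * \<mu> * cnj (zc p)"

definition T :: "complex \<Rightarrow> real \<times> real \<Rightarrow> complex" where
  "T \<mu> p = zc p ^ 3 + \<mu>"

definition S :: "complex \<Rightarrow> real \<times> real \<Rightarrow> real" where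
  "S \<mu> p = (cmod (T \<mu> p))\<^sup>2 + 36 * cmod (zc p) ^ 4 + 576 * (cmod (zc p))\<^sup>2 + 2304"

definition Q :: "complex \<Rightarrow> real \<times> real \<Rightarrow> real" where
  "Q \<mu> p = (cmod (W \<mu> p))\<^sup>2 + 16 * S \<mu> p"

definition Psi_tilde :: "complex \<Rightarrow> real \<times> real \<Rightarrow> complex" where
  "Psi_tilde \<mu> p = W \<mu> p / complex_of_real (sqrt (Q \<mu> p))"

definition f_bil :: "complex \<Rightarrow> real \<times> real \<Rightarrow> complex" where
  "f_bil \<mu> p = complex_of_real (Q \<mu> p)"

definition g_bil :: "complex \<Rightarrow> real \<times> real \<Rightarrow> complex" where
  "g_bil \<mu> p = (W \<mu> p)\<^sup>2"

definition h_bil :: "complex \<Rightarrow> real \<times> real \<Rightarrow> complex" where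
  "h_bil \<mu> p = 192 * zc p * (zc p ^ 3 + 4 * \<mu>)"

section \<open>The family with a real parameter\<close>

definition R_al :: "real \<Rightarrow> real \<times> real \<Rightarrow> real" where
  "R_al \<alpha> = (\<lambda>(x, y). x\<^sup>2 - y\<^sup>2 - \<alpha> * x + \<alpha> * y)"

definition I_al :: "real \<Rightarrow> real \<times> real \<Rightarrow> real" where
  "I_al \<alpha> = (\<lambda>(x, y). 2 * x * y + \<alpha> * x + \<alpha> * y)"

definition N1 :: "real \<Rightarrow> real \<times> real \<Rightarrow> real" where
  "N1 \<alpha> = (\<lambda>(x, y).
     ((x\<^sup>2 + y\<^sup>2) + 24 + \<alpha> * (x + y) + 2 * \<alpha>\<^sup>2) * R_al \<alpha> (x, y)
     + \<alpha> * (- x + y) * I_al \<alpha> (x, y))"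

definition N2 :: "real \<Rightarrow> real \<times> real \<Rightarrow> real" where
  "N2 \<alpha> = (\<lambda>(x, y).
     \<alpha> * (- x + y) * R_al \<alpha> (x, y)
     + ((x\<^sup>2 + y\<^sup>2) + 24 - \<alpha> * (x + y) + 2 * \<alpha>\<^sup>2) * I_al \<alpha> (x, y))"

definition P_al :: "real \<Rightarrow> real \<times> real \<Rightarrow> real" where
  "P_al \<alpha> = (\<lambda>(x, y). let r2 = x\<^sup>2 + y\<^sup>2 in
     r2 ^ 4 + 64 * r2 ^ 3 + 1152 * r2 ^ 2 + 9216 * r2 + 36864
     + \<alpha> * (- 48 * x^5 + 144 * x^4 * y + 96 * x^3 * y^2 - 768 * x^3 + 96 * x^2 * y^3
            + 2304 * x^2 * y + 144 * x * y^4 + 2304 * x * y^2 - 48 * y^5 - 768 * y^3)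
     + \<alpha>^2 * (1152 * r2 + 4608)
     + \<alpha>^3 * (- 4 * x^5 + 12 * x^4 * y + 8 * x^3 * y^2 - 64 * x^3 + 8 * x^2 * y^3
            + 192 * x^2 * y + 12 * x * y^4 + 192 * x * y^2 - 4 * y^5 - 64 * y^3)
     + \<alpha>^4 * (192 * r2 + 768) + \<alpha>^6 * (8 * r2 + 32))"

definition Psi_al :: "real \<Rightarrow> real \<times> real \<Rightarrow> complex" where
  "Psi_al \<alpha> p =
     (complex_of_real (N1 \<alpha> p) + \<i> * complex_of_real (N2 \<alpha> p)) / complex_of_real (sqrt (P_al \<alpha> p))"

end

theory Submission
  imports Defs
begin

text \<open>
  In the coordinates \<open>z\<close> and \<open>w = cnj z\<close> everything is polynomial,
  \<open>\<Delta> = 4 \<partial>\<^sub>z\<partial>\<^sub>w\<close> and \<open>\<nabla>F \<bullet> \<nabla>G = 2 (F\<^sub>z G\<^sub>w + F\<^sub>w G\<^sub>z)\<close>. The bilinear identities for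
  \<open>g = W\<^sup>2\<close> reduce to \<open>D\<^sup>2 W \<cdot> W = h\<close> and, after cancelling one factor \<open>W\<close>, to
  \<open>4 (f \<Delta>W - \<nabla>W \<bullet> \<nabla>f) + W \<Delta>f = h \<cdot> cnj W - 16 S W\<close>. Unlike the identities for \<open>g\<close>, these two
  and \<open>D\<^sup>2 f \<cdot> f = 512 S\<^sup>2\<close> yield the equation for \<open>W / \<surd>f\<close> also at the zeros of \<open>W\<close>: cleared
  of denominators, the equation is a linear combination of the three. The zeros of \<open>W\<close> other than
  the origin are the cube roots of a single number, because taking moduli in \<open>z W = 0\<close> determines
  \<open>|z|\<close>.
\<close>

section \<open>Wirtinger derivatives\<close>

text \<open>The numbers \<open>a\<close> and \<open>b\<close> are the Wirtinger derivatives with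
  respect to \<open>z\<close> and \<open>cnj z\<close>. Every real-linear map from the plane to the
  complex numbers has this form, so this is ordinary real differentiability.\<close>

definition has_wirtinger ::
  "(real \<times> real \<Rightarrow> complex) \<Rightarrow> complex \<Rightarrow> complex \<Rightarrow> real \<times> real \<Rightarrow> bool" where
  "has_wirtinger F a b p \<longleftrightarrow> (F has_derivative (\<lambda>h. a * zc h + b * cnj (zc h))) (at p)"

lemma zc_eq: "zc p = complex_of_real (fst p) + \<i> * complex_of_real (snd p)"
  by (simp add: zc_def complex_eq_iff)

lemma zc_add: "zc (p + q) = zc p + zc q"
  by (simp add: zc_def complex_eq_iff)

lemma zc_zero [simp]: "zc 0 = 0"
  by (simp add: zc_def complex_eq_iff)

lemma zc_eq_iff: "zc p = zc q \<longleftrightarrow> p = q"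
  by (simp add: zc_def prod_eq_iff)

lemma bounded_linear_zc: "bounded_linear zc"
  unfolding zc_eq [abs_def]
  by (intro bounded_linear_add bounded_linear_mult_right [THEN bounded_linear_compose]
        bounded_linear_of_real [THEN bounded_linear_compose] bounded_linear_fst bounded_linear_snd)

lemma has_wirtinger_const: "has_wirtinger (\<lambda>p. c) 0 0 p"
  by (simp add: has_wirtinger_def)

lemma has_wirtinger_zc: "has_wirtinger zc 1 0 p"
  using bounded_linear_imp_has_derivative [OF bounded_linear_zc] by (simp add: has_wirtinger_def)

lemma has_wirtinger_cnj:
  assumes "has_wirtinger F a b p"
  shows "has_wirtinger (\<lambda>p. cnj (F p)) (cnj b) (cnj a) p"
  using has_derivative_cnj [OF assms [unfolded has_wirtinger_def]]
  by (simp add: has_wirtinger_def add.commute)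

lemma has_wirtinger_add:
  assumes "has_wirtinger F a b p" "has_wirtinger G c d p"
  shows "has_wirtinger (\<lambda>p. F p + G p) (a + c) (b + d) p"
  using has_derivative_add [OF assms [unfolded has_wirtinger_def]]
  by (simp add: has_wirtinger_def algebra_simps)

lemma has_wirtinger_mult:
  assumes "has_wirtinger F a b p" "has_wirtinger G c d p"
  shows "has_wirtinger (\<lambda>p. F p * G p) (a * G p + F p * c) (b * G p + F p * d) p"
  using has_derivative_mult [OF assms [unfolded has_wirtinger_def]]
  by (simp add: has_wirtinger_def algebra_simps)

text \<open>The outer function is complex differentiable at \<open>F p\<close>, so its single
  derivative \<open>d\<close> multiplies both Wirtinger derivatives.\<close>

lemma has_wirtinger_chain:
  assumes "has_wirtinger F a b p" "(G has_field_derivative d) (at (F p))"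
  shows "has_wirtinger (\<lambda>p. G (F p)) (d * a) (d * b) p"
  using has_derivative_compose [OF assms(1) [unfolded has_wirtinger_def]
      assms(2) [unfolded has_field_derivative_def]]
  by (simp add: has_wirtinger_def algebra_simps)

lemma has_wirtinger_imp_differentiable: "has_wirtinger F a b p \<Longrightarrow> F differentiable (at p)"
  unfolding has_wirtinger_def differentiable_def by blast

text \<open>The directions \<open>(1, 0)\<close> and \<open>(0, 1)\<close> are \<open>z = 1\<close>
  and \<open>z = \<i>\<close>, with conjugates \<open>1\<close> and \<open>- \<i>\<close>.\<close>

lemma partials_wirtinger:
  assumes "has_wirtinger F a b p"
  shows "partial_x F p = a + b" "partial_y F p = \<i> * (a - b)"
  using frechet_derivative_at [OF assms [unfolded has_wirtinger_def], symmetric]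
  by (simp_all add: partial_x_def partial_y_def zc_eq algebra_simps)

section \<open>Second order jets\<close>

text \<open>The suffixes \<open>z\<close> and \<open>w\<close> denote the derivatives with respect to \<open>z\<close> and \<open>cnj z\<close>.\<close>

definition has_jet ::
  "(real \<times> real \<Rightarrow> complex) \<Rightarrow> (real \<times> real \<Rightarrow> complex) \<Rightarrow> (real \<times> real \<Rightarrow> complex) \<Rightarrow>
   (real \<times> real \<Rightarrow> complex) \<Rightarrow> (real \<times> real \<Rightarrow> complex) \<Rightarrow> (real \<times> real \<Rightarrow> complex) \<Rightarrow> bool" where
  "has_jet F Fz Fw Fzz Fzw Fww \<longleftrightarrow>
     (\<forall>p. has_wirtinger F (Fz p) (Fw p) p \<and> has_wirtinger Fz (Fzz p) (Fzw p) p \<and>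
          has_wirtinger Fw (Fzw p) (Fww p) p) \<and>
     continuous_on UNIV Fzz \<and> continuous_on UNIV Fzw \<and> continuous_on UNIV Fww"

text \<open>Serves to replace the expressions produced by the sum and product rules by closed
  forms.\<close>

lemma has_jet_eq:
  assumes "has_jet F Fz Fw Fzz Fzw Fww"
    and "\<And>p. F p = G p" "\<And>p. Fz p = Gz p" "\<And>p. Fw p = Gw p"
    and "\<And>p. Fzz p = Gzz p" "\<And>p. Fzw p = Gzw p" "\<And>p. Fww p = Gww p"
  shows "has_jet G Gz Gw Gzz Gzw Gww"
proof -
  have "F = G" "Fz = Gz" "Fw = Gw" "Fzz = Gzz" "Fzw = Gzw" "Fww = Gww"
    using assms(2-) by auto
  then show ?thesis using assms(1) by simp
qed

lemma has_wirtinger_imp_continuous_on: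
  "(\<And>p. has_wirtinger F (a p) (b p) p) \<Longrightarrow> continuous_on A F"
  by (meson differentiable_imp_continuous_within continuous_at_imp_continuous_on
      has_wirtinger_imp_differentiable)

lemma has_jetD:
  assumes "has_jet F Fz Fw Fzz Fzw Fww"
  shows "has_wirtinger F (Fz p) (Fw p) p" "has_wirtinger Fz (Fzz p) (Fzw p) p"
    "has_wirtinger Fw (Fzw p) (Fww p) p"
  using assms unfolding has_jet_def by blast+

lemma has_jet_continuous:
  assumes "has_jet F Fz Fw Fzz Fzw Fww"
  shows "continuous_on UNIV F" "continuous_on UNIV Fz" "continuous_on UNIV Fw"
    "continuous_on UNIV Fzz" "continuous_on UNIV Fzw" "continuous_on UNIV Fww"
  using has_jetD [OF assms, THEN has_wirtinger_imp_continuous_on] assms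
  unfolding has_jet_def by blast+

lemma has_jet_const: "has_jet (\<lambda>p. c) (\<lambda>p. 0) (\<lambda>p. 0) (\<lambda>p. 0) (\<lambda>p. 0) (\<lambda>p. 0)"
  by (simp add: has_jet_def has_wirtinger_const)

lemma has_jet_zc: "has_jet zc (\<lambda>p. 1) (\<lambda>p. 0) (\<lambda>p. 0) (\<lambda>p. 0) (\<lambda>p. 0)"
  by (simp add: has_jet_def has_wirtinger_const has_wirtinger_zc)

lemma has_jet_cnj:
  assumes "has_jet F Fz Fw Fzz Fzw Fww"
  shows "has_jet (\<lambda>p. cnj (F p)) (\<lambda>p. cnj (Fw p)) (\<lambda>p. cnj (Fz p))
           (\<lambda>p. cnj (Fww p)) (\<lambda>p. cnj (Fzw p)) (\<lambda>p. cnj (Fzz p))"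
  using assms unfolding has_jet_def by (blast intro: has_wirtinger_cnj continuous_intros)

lemma has_jet_add:
  assumes "has_jet F Fz Fw Fzz Fzw Fww" "has_jet G Gz Gw Gzz Gzw Gww"
  shows "has_jet (\<lambda>p. F p + G p) (\<lambda>p. Fz p + Gz p) (\<lambda>p. Fw p + Gw p)
           (\<lambda>p. Fzz p + Gzz p) (\<lambda>p. Fzw p + Gzw p) (\<lambda>p. Fww p + Gww p)"
  using assms unfolding has_jet_def by (blast intro: has_wirtinger_add continuous_intros)

text \<open>The Leibniz rule to second order. The mixed derivative is reached from the
  \<open>z\<close>-derivative and from the \<open>w\<close>-derivative, and both routes must give
  the one entry \<open>Fzw\<close> that \<open>has_jet\<close> admits.\<close>

lemma has_jet_mult:
  assumes F: "has_jet F Fz Fw Fzz Fzw Fww" and G: "has_jet G Gz Gw Gzz Gzw Gww"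
  shows "has_jet (\<lambda>p. F p * G p) (\<lambda>p. Fz p * G p + F p * Gz p) (\<lambda>p. Fw p * G p + F p * Gw p)
           (\<lambda>p. Fzz p * G p + 2 * Fz p * Gz p + F p * Gzz p)
           (\<lambda>p. Fzw p * G p + Fz p * Gw p + Fw p * Gz p + F p * Gzw p)
           (\<lambda>p. Fww p * G p + 2 * Fw p * Gw p + F p * Gww p)"
proof -
  note w = has_wirtinger_add [OF has_wirtinger_mult has_wirtinger_mult]
  note FG = has_jetD [OF F] has_jetD [OF G]
  have "has_wirtinger (\<lambda>p. Fz p * G p + F p * Gz p)
      (Fzz p * G p + 2 * Fz p * Gz p + F p * Gzz p)
      (Fzw p * G p + Fz p * Gw p + Fw p * Gz p + F p * Gzw p) p" for p
    using w [OF FG(2) FG(4) FG(1) FG(5), of p] by (simp add: algebra_simps)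
  moreover have "has_wirtinger (\<lambda>p. Fw p * G p + F p * Gw p)
      (Fzw p * G p + Fz p * Gw p + Fw p * Gz p + F p * Gzw p)
      (Fww p * G p + 2 * Fw p * Gw p + F p * Gww p) p" for p
    using w [OF FG(3) FG(4) FG(1) FG(6), of p] by (simp add: algebra_simps)
  ultimately show ?thesis
    unfolding has_jet_def
    by (intro conjI allI has_wirtinger_mult FG continuous_intros has_jet_continuous [OF F]
        has_jet_continuous [OF G]) auto
qed

section \<open>The inverse square root of a positive function\<close>

lemma has_field_derivative_inverse_csqrt:
  assumes "z \<notin> \<real>\<^sub>\<le>\<^sub>0"
  shows "((\<lambda>z. inverse (csqrt z)) has_field_derivative - (1/2) * inverse (csqrt z) ^ 3) (at z)"
proof -
  have "csqrt z \<noteq> 0" using assms by auto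
  then show ?thesis
    using assms
    by (auto intro!: derivative_eq_intros simp: field_simps power2_eq_square power3_eq_cube)
qed

text \<open>As \<open>G\<close> is real and positive, its values avoid the branch cut and
  \<open>s\<close> is \<open>inverse (csqrt z)\<close> composed with \<open>G\<close>. Derivatives
  are written in powers of \<open>s\<close>, which keeps the later algebra polynomial.\<close>

lemma has_jet_inverse_sqrt:
  assumes G: "has_jet G Gz Gw Gzz Gzw Gww"
    and pos: "\<And>p. G p = complex_of_real (g p)" "\<And>p. 0 < g p"
  defines "s \<equiv> \<lambda>p. complex_of_real (inverse (sqrt (g p)))"
  shows "has_jet s (\<lambda>p. - (1/2) * Gz p * s p ^ 3) (\<lambda>p. - (1/2) * Gw p * s p ^ 3)
           (\<lambda>p. - (1/2) * Gzz p * s p ^ 3 + 3/4 * Gz p * Gz p * s p ^ 5)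
           (\<lambda>p. - (1/2) * Gzw p * s p ^ 3 + 3/4 * Gz p * Gw p * s p ^ 5)
           (\<lambda>p. - (1/2) * Gww p * s p ^ 3 + 3/4 * Gw p * Gw p * s p ^ 5)"
proof -
  have s_eq: "s p = inverse (csqrt (G p))" for p
    using pos(2) [of p] by (simp add: s_def pos(1))
  note G1 = has_jetD [OF G]
  have nonneg: "G p \<notin> \<real>\<^sub>\<le>\<^sub>0" for p
    using pos(2) [of p] by (simp add: pos(1) nonpos_Reals_of_real_iff not_le)
  have s1: "has_wirtinger s (- (1/2) * Gz p * s p ^ 3) (- (1/2) * Gw p * s p ^ 3) p" for p
    using has_wirtinger_chain [OF G1(1) has_field_derivative_inverse_csqrt [OF nonneg], of p]
    unfolding s_eq [symmetric] by (simp add: mult_ac)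
  \<comment> \<open>Differentiates the common factor of the first derivatives:
    \<open>- (3/2) * s ^ 2\<close> times \<open>- (1/2) * s ^ 3\<close> is
    \<open>3/4 * s ^ 5\<close>.\<close>
  have cube: "((\<lambda>x. - (1/2) * x ^ 3) has_field_derivative - (3/2) * x ^ 2) (at x)" for x :: complex
    by (auto intro!: derivative_eq_intros)
  have s3: "has_wirtinger (\<lambda>p. - (1/2) * s p ^ 3)
      (3/4 * Gz p * s p ^ 5) (3/4 * Gw p * s p ^ 5) p" for p
    using has_wirtinger_chain [OF s1 cube, of p] by (simp add: eval_nat_numeral mult_ac)
  have "has_wirtinger (\<lambda>p. - (1/2) * Gz p * s p ^ 3)
      (- (1/2) * Gzz p * s p ^ 3 + 3/4 * Gz p * Gz p * s p ^ 5)
      (- (1/2) * Gzw p * s p ^ 3 + 3/4 * Gz p * Gw p * s p ^ 5) p" for p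
    using has_wirtinger_mult [OF G1(2) s3, of p] by (simp add: mult_ac)
  moreover have "has_wirtinger (\<lambda>p. - (1/2) * Gw p * s p ^ 3)
      (- (1/2) * Gzw p * s p ^ 3 + 3/4 * Gz p * Gw p * s p ^ 5)
      (- (1/2) * Gww p * s p ^ 3 + 3/4 * Gw p * Gw p * s p ^ 5) p" for p
    using has_wirtinger_mult [OF G1(3) s3, of p] by (simp add: mult_ac)
  moreover have "continuous_on UNIV s"
    using s1 by (rule has_wirtinger_imp_continuous_on)
  ultimately show ?thesis
    unfolding has_jet_def
    by (intro conjI allI s1 continuous_intros has_jet_continuous [OF G]) auto
qed

section \<open>The differential operators in terms of jets\<close>

lemma
  assumes "has_jet F Fz Fw Fzz Fzw Fww"
  shows laplacian_jet: "laplacian F p = 4 * Fzw p"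
    and C2_on_plane_jet: "C2_on_plane F"
proof -
  note F = has_jetD [OF assms]
  \<comment> \<open>The difference in \<open>py\<close> is written with a factor \<open>- 1\<close>
    to fit the sum and product rules.\<close>
  have px: "partial_x F = (\<lambda>p. Fz p + Fw p)"
    and py: "partial_y F = (\<lambda>p. \<i> * (Fz p + (- 1) * Fw p))"
    using partials_wirtinger [OF F(1)] by auto
  have dx: "has_wirtinger (partial_x F) (Fzz p + Fzw p) (Fzw p + Fww p) p" for p
    unfolding px by (intro has_wirtinger_add F)
  have dy: "has_wirtinger (partial_y F) (\<i> * (Fzz p - Fzw p)) (\<i> * (Fzw p - Fww p)) p" for p
    unfolding py
    using has_wirtinger_mult [OF has_wirtinger_const [of \<i>]
        has_wirtinger_add [OF F(2) has_wirtinger_mult [OF has_wirtinger_const [of "-1"] F(3)]]]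
    by simp
  \<comment> \<open>The sum is \<open>(Fzz + 2 * Fzw + Fww) - (Fzz - 2 * Fzw + Fww)\<close>.\<close>
  show "laplacian F p = 4 * Fzw p"
    by (simp add: laplacian_def partials_wirtinger [OF dx] partials_wirtinger [OF dy]
        algebra_simps)
  show "C2_on_plane F"
    unfolding C2_on_plane_def partials_wirtinger [OF dx, abs_def] partials_wirtinger [OF dy, abs_def]
    by (intro conjI continuous_intros has_jet_continuous [OF assms])
      (auto simp: differentiable_on_def intro: has_wirtinger_imp_differentiable F dx dy)
qed

lemma grad_dot_jet:
  assumes "has_jet F Fz Fw Fzz Fzw Fww" "has_jet G Gz Gw Gzz Gzw Gww"
  shows "grad_dot F G p = 2 * (Fz p * Gw p + Fw p * Gz p)"
  by (simp add: grad_dot_def partials_wirtinger [OF has_jetD(1) [OF assms(1)]]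
      partials_wirtinger [OF has_jetD(1) [OF assms(2)]] algebra_simps)

lemma grad_dot_self_jet:
  assumes "has_jet F Fz Fw Fzz Fzw Fww"
  shows "grad_dot F F p = 4 * (Fz p * Fw p)"
  by (simp add: grad_dot_jet [OF assms assms])

text \<open>Just as the Laplacian is four times the mixed Wirtinger derivative, the Hirota operator
  is four times the product of the Hirota operators in \<open>z\<close> and
  \<open>w\<close>.\<close>

lemma hirota_D2_jet:
  assumes "has_jet F Fz Fw Fzz Fzw Fww" "has_jet G Gz Gw Gzz Gzw Gww"
  shows "hirota_D2 F G p =
    4 * (Fzw p * G p - (Fz p * Gw p + Fw p * Gz p) + F p * Gzw p)"
  by (simp add: hirota_D2_def laplacian_jet [OF assms(1)] laplacian_jet [OF assms(2)]
      grad_dot_jet [OF assms] algebra_simps)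

section \<open>The bilinear identities\<close>

text \<open>Here \<open>w\<close> and \<open>n\<close> stand for \<open>cnj z\<close> and \<open>cnj \<mu>\<close>, treated as independent variables.\<close>

context
  fixes z w m n :: "'a :: idom"
  fixes W Wz Ww Wzw V Vz Vw Vzw S Sz Sw Szw
  assumes W: "W = z^3 * w + 24 * z^2 - 2 * m * w" "Wz = 3 * z^2 * w + 48 * z"
      "Ww = z^3 - 2 * m" "Wzw = 3 * z^2"
    and V: "V = w^3 * z + 24 * w^2 - 2 * n * z" "Vw = 3 * w^2 * z + 48 * w"
      "Vz = w^3 - 2 * n" "Vzw = 3 * w^2"
    and S: "S = (z^3 + m) * (w^3 + n) + 36 * z^2 * w^2 + 576 * z * w + 2304"
      "Sz = 3 * z^2 * (w^3 + n) + 72 * z * w^2 + 576 * w"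
      "Sw = 3 * w^2 * (z^3 + m) + 72 * z^2 * w + 576 * z"
      "Szw = 9 * z^2 * w^2 + 144 * z * w + 576"
begin

text \<open>The left side is the Hirota operator applied to \<open>W\<close> and \<open>W\<close>.
  All terms containing \<open>w\<close> cancel, so the result is holomorphic in
  \<open>z\<close>.\<close>

lemma hirota_WW: "8 * (W * Wzw - Wz * Ww) = 192 * z * (z^3 + 4 * m)"
  unfolding W by algebra

text \<open>The left side is half of the Hirota operator applied twice to
  \<open>f = W * V + 16 * S\<close>.\<close>

lemma hirota_QQ:
  "4 * ((W * V + 16 * S) * (Wzw * V + Wz * Vw + Ww * Vz + W * Vzw + 16 * Szw)
      - (Wz * V + W * Vz + 16 * Sz) * (Ww * V + W * Vw + 16 * Sw)) = 256 * S^2"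
  unfolding W V S by algebra

text \<open>What remains of the identity for \<open>g = W^2\<close> and \<open>f\<close> after
  \<open>hirota_WW\<close> is used and one factor \<open>W\<close> is divided out.\<close>

lemma hirota_WQ:
  "16 * (W * V + 16 * S) * Wzw
      - 8 * (Wz * (Ww * V + W * Vw + 16 * Sw) + Ww * (Wz * V + W * Vz + 16 * Sz))
      + 4 * W * (Wzw * V + Wz * Vw + Ww * Vz + W * Vzw + 16 * Szw)
    = 192 * z * (z^3 + 4 * m) * V - 16 * S * W"
  unfolding W V S by algebra

end


section \<open>Closed forms of the derivatives of \<open>W\<close>, \<open>S\<close> and
  \<open>f\<close>\<close>

definition Wz :: "complex \<Rightarrow> real \<times> real \<Rightarrow> complex" where
  "Wz \<mu> p = 3 * zc p ^ 2 * cnj (zc p) + 48 * zc p"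

definition Ww :: "complex \<Rightarrow> real \<times> real \<Rightarrow> complex" where
  "Ww \<mu> p = zc p ^ 3 - 2 * \<mu>"

definition Wzz :: "complex \<Rightarrow> real \<times> real \<Rightarrow> complex" where
  "Wzz \<mu> p = 6 * zc p * cnj (zc p) + 48"

definition Wzw :: "complex \<Rightarrow> real \<times> real \<Rightarrow> complex" where
  "Wzw \<mu> p = 3 * zc p ^ 2"

definition Sz :: "complex \<Rightarrow> real \<times> real \<Rightarrow> complex" where
  "Sz \<mu> p = 3 * zc p ^ 2 * (cnj (zc p) ^ 3 + cnj \<mu>) + 72 * zc p * cnj (zc p) ^ 2 + 576 * cnj (zc p)"

definition Sw :: "complex \<Rightarrow> real \<times> real \<Rightarrow> complex" where
  "Sw \<mu> p = 3 * cnj (zc p) ^ 2 * (zc p ^ 3 + \<mu>) + 72 * zc p ^ 2 * cnj (zc p) + 576 * zc p"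

definition Szz :: "complex \<Rightarrow> real \<times> real \<Rightarrow> complex" where
  "Szz \<mu> p = 6 * zc p * (cnj (zc p) ^ 3 + cnj \<mu>) + 72 * cnj (zc p) ^ 2"

definition Szw :: "complex \<Rightarrow> real \<times> real \<Rightarrow> complex" where
  "Szw \<mu> p = 9 * zc p ^ 2 * cnj (zc p) ^ 2 + 144 * zc p * cnj (zc p) + 576"

definition Sww :: "complex \<Rightarrow> real \<times> real \<Rightarrow> complex" where
  "Sww \<mu> p = 6 * cnj (zc p) * (zc p ^ 3 + \<mu>) + 72 * zc p ^ 2"

text \<open>Product rule for \<open>W * cnj W + 16 * S\<close>: conjugation exchanges the two
  derivatives, so the \<open>z\<close>-derivative of \<open>cnj W\<close> is
  \<open>cnj Ww\<close>.\<close>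

definition fz :: "complex \<Rightarrow> real \<times> real \<Rightarrow> complex" where
  "fz \<mu> p = Wz \<mu> p * cnj (W \<mu> p) + W \<mu> p * cnj (Ww \<mu> p) + 16 * Sz \<mu> p"

definition fw :: "complex \<Rightarrow> real \<times> real \<Rightarrow> complex" where
  "fw \<mu> p = Ww \<mu> p * cnj (W \<mu> p) + W \<mu> p * cnj (Wz \<mu> p) + 16 * Sw \<mu> p"

text \<open>As \<open>W\<close> is affine in \<open>cnj z\<close>, the second
  \<open>w\<close>-derivative of \<open>W\<close> contributes nothing, here and in
  \<open>fww\<close>.\<close>

definition fzz :: "complex \<Rightarrow> real \<times> real \<Rightarrow> complex" where
  "fzz \<mu> p = Wzz \<mu> p * cnj (W \<mu> p) + 2 * Wz \<mu> p * cnj (Ww \<mu> p) + 16 * Szz \<mu> p"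

definition fzw :: "complex \<Rightarrow> real \<times> real \<Rightarrow> complex" where
  "fzw \<mu> p = Wzw \<mu> p * cnj (W \<mu> p) + Wz \<mu> p * cnj (Wz \<mu> p) + Ww \<mu> p * cnj (Ww \<mu> p)
     + W \<mu> p * cnj (Wzw \<mu> p) + 16 * Szw \<mu> p"

definition fww :: "complex \<Rightarrow> real \<times> real \<Rightarrow> complex" where
  "fww \<mu> p = 2 * Ww \<mu> p * cnj (Wz \<mu> p) + W \<mu> p * cnj (Wzz \<mu> p) + 16 * Sww \<mu> p"

lemma W_poly: "W \<mu> p = zc p ^ 3 * cnj (zc p) + 24 * zc p ^ 2 - 2 * \<mu> * cnj (zc p)"
  unfolding W_def complex_norm_square by (simp add: power2_eq_square power3_eq_cube algebra_simps)

lemma S_poly: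
  "complex_of_real (S \<mu> p) = (zc p ^ 3 + \<mu>) * (cnj (zc p) ^ 3 + cnj \<mu>)
     + 36 * zc p ^ 2 * cnj (zc p) ^ 2 + 576 * zc p * cnj (zc p) + 2304"
proof -
  have "complex_of_real (S \<mu> p) = complex_of_real ((cmod (T \<mu> p))\<^sup>2)
      + 36 * (complex_of_real ((cmod (zc p))\<^sup>2))\<^sup>2 + 576 * complex_of_real ((cmod (zc p))\<^sup>2) + 2304"
    by (simp add: S_def)
  then show ?thesis
    unfolding complex_norm_square T_def by (simp add: power_mult_distrib mult.assoc)
qed

lemma f_bil_eq: "f_bil \<mu> p = W \<mu> p * cnj (W \<mu> p) + 16 * complex_of_real (S \<mu> p)"
  by (simp add: f_bil_def Q_def flip: complex_norm_square)

lemma has_jet_W: "has_jet (W \<mu>) (Wz \<mu>) (Ww \<mu>) (Wzz \<mu>) (Wzw \<mu>) (\<lambda>p. 0)"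
proof -
  note zw = has_jet_mult [OF has_jet_zc has_jet_cnj [OF has_jet_zc]]
    and z2 = has_jet_mult [OF has_jet_zc has_jet_zc]
  show ?thesis
    by (rule has_jet_eq [OF has_jet_add [OF has_jet_mult [OF has_jet_add [OF zw has_jet_const [of 24]] z2]
            has_jet_mult [OF has_jet_const [of "- 2 * \<mu>"] has_jet_cnj [OF has_jet_zc]]]])
      (simp_all add: W_poly Wz_def Ww_def Wzz_def Wzw_def power2_eq_square power3_eq_cube algebra_simps)
qed

lemma has_jet_S:
  "has_jet (\<lambda>p. complex_of_real (S \<mu> p)) (Sz \<mu>) (Sw \<mu>) (Szz \<mu>) (Szw \<mu>) (Sww \<mu>)"
proof -
  note zw = has_jet_mult [OF has_jet_zc has_jet_cnj [OF has_jet_zc]]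
    and T = has_jet_add [OF has_jet_mult [OF has_jet_mult [OF has_jet_zc has_jet_zc] has_jet_zc]
        has_jet_const [of \<mu>]]
  show ?thesis
    by (rule has_jet_eq [OF has_jet_add [OF has_jet_add [OF has_jet_mult [OF T has_jet_cnj [OF T]]
            has_jet_mult [OF has_jet_const [of 36] has_jet_mult [OF zw zw]]]
          has_jet_add [OF has_jet_mult [OF has_jet_const [of 576] zw] has_jet_const [of 2304]]]])
      (simp_all add: S_poly Sz_def Sw_def Szz_def Szw_def Sww_def
        power2_eq_square power3_eq_cube algebra_simps)
qed

lemma has_jet_f_bil: "has_jet (f_bil \<mu>) (fz \<mu>) (fw \<mu>) (fzz \<mu>) (fzw \<mu>) (fww \<mu>)"
  by (rule has_jet_eq [OF has_jet_add [OF has_jet_mult [OF has_jet_W has_jet_cnj [OF has_jet_W]]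
          has_jet_mult [OF has_jet_const [of 16] has_jet_S]]])
    (simp_all add: f_bil_eq fz_def fw_def fzz_def fzw_def fww_def)

lemma has_jet_g_bil:
  "has_jet (g_bil \<mu>) (\<lambda>p. 2 * W \<mu> p * Wz \<mu> p) (\<lambda>p. 2 * W \<mu> p * Ww \<mu> p)
     (\<lambda>p. 2 * Wz \<mu> p ^ 2 + 2 * W \<mu> p * Wzz \<mu> p)
     (\<lambda>p. 2 * Wz \<mu> p * Ww \<mu> p + 2 * W \<mu> p * Wzw \<mu> p)
     (\<lambda>p. 2 * Ww \<mu> p ^ 2)"
  by (rule has_jet_eq [OF has_jet_mult [OF has_jet_W has_jet_W]])
    (simp_all add: g_bil_def power2_eq_square algebra_simps)

lemma cnj_W_poly:
  "cnj (W \<mu> p) = cnj (zc p) ^ 3 * zc p + 24 * cnj (zc p) ^ 2 - 2 * cnj \<mu> * zc p"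
  "cnj (Wz \<mu> p) = 3 * cnj (zc p) ^ 2 * zc p + 48 * cnj (zc p)"
  "cnj (Ww \<mu> p) = cnj (zc p) ^ 3 - 2 * cnj \<mu>"
  "cnj (Wzw \<mu> p) = 3 * cnj (zc p) ^ 2"
  by (simp_all add: W_poly Wz_def Ww_def Wzw_def)

text \<open>The order matches the assumptions of the context of \<open>hirota_WW\<close>, with
  \<open>V = cnj W\<close>, \<open>Vw = cnj Wz\<close> and \<open>Vz = cnj Ww\<close>.\<close>

lemmas polys = W_poly Wz_def Ww_def Wzw_def cnj_W_poly S_poly Sz_def Sw_def Szw_def

lemma bilinear_WW: "8 * (W \<mu> p * Wzw \<mu> p - Wz \<mu> p * Ww \<mu> p) = h_bil \<mu> p"
  unfolding h_bil_def by (rule hirota_WW [OF polys])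

lemma bilinear_ff:
  "4 * (f_bil \<mu> p * fzw \<mu> p - fz \<mu> p * fw \<mu> p) = 256 * (complex_of_real (S \<mu> p))\<^sup>2"
  unfolding f_bil_eq fz_def fw_def fzw_def by (rule hirota_QQ [OF polys])

lemma bilinear_Wf:
  "16 * f_bil \<mu> p * Wzw \<mu> p - 8 * (Wz \<mu> p * fw \<mu> p + Ww \<mu> p * fz \<mu> p) + 4 * W \<mu> p * fzw \<mu> p
     = h_bil \<mu> p * cnj (W \<mu> p) - 16 * complex_of_real (S \<mu> p) * W \<mu> p"
  unfolding f_bil_eq fz_def fw_def fzw_def h_bil_def by (rule hirota_WQ [OF polys])

lemma S_pos: "0 < S \<mu> p"
  unfolding S_def by (intro add_nonneg_pos add_nonneg_nonneg) auto

lemma Q_pos: "0 < Q \<mu> p"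
  unfolding Q_def using S_pos [of \<mu> p] by (intro add_nonneg_pos) auto

lemma bilinear_identities:
  "(Psi_tilde \<mu> p)\<^sup>2 = g_bil \<mu> p / f_bil \<mu> p"
  "hirota_D2 (f_bil \<mu>) (f_bil \<mu>) p = 512 * (complex_of_real (S \<mu> p))\<^sup>2"
  "512 * (complex_of_real (S \<mu> p))\<^sup>2
     = 2 * (f_bil \<mu> p - complex_of_real (cmod (g_bil \<mu> p)))\<^sup>2"
  "hirota_D2 (g_bil \<mu>) (g_bil \<mu>) p = 2 * g_bil \<mu> p * h_bil \<mu> p"
  "hirota_D2 (g_bil \<mu>) (f_bil \<mu>) p
     = - 16 * complex_of_real (S \<mu> p) * (g_bil \<mu> p + h_bil \<mu> p)"
proof -
  show "(Psi_tilde \<mu> p)\<^sup>2 = g_bil \<mu> p / f_bil \<mu> p"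
    using Q_pos [of \<mu> p]
    by (simp add: Psi_tilde_def g_bil_def f_bil_def power_divide flip: of_real_power)
  show "hirota_D2 (f_bil \<mu>) (f_bil \<mu>) p = 512 * (complex_of_real (S \<mu> p))\<^sup>2"
    using bilinear_ff [of \<mu> p] unfolding hirota_D2_jet [OF has_jet_f_bil has_jet_f_bil] by algebra
  \<comment> \<open>The modulus of \<open>g\<close> is that of \<open>W\<close> squared, so only the
    \<open>16 * S\<close> in \<open>Q\<close> survives.\<close>
  have "f_bil \<mu> p - complex_of_real (cmod (g_bil \<mu> p)) = 16 * complex_of_real (S \<mu> p)"
    by (simp add: f_bil_def g_bil_def Q_def norm_power)
  then show "512 * (complex_of_real (S \<mu> p))\<^sup>2
     = 2 * (f_bil \<mu> p - complex_of_real (cmod (g_bil \<mu> p)))\<^sup>2"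
    by (simp add: power_mult_distrib)
  \<comment> \<open>For any square \<open>W^2\<close> the result is \<open>2 * W^2\<close> times the
    Hirota operator applied to \<open>W\<close> and \<open>W\<close>.\<close>
  show "hirota_D2 (g_bil \<mu>) (g_bil \<mu>) p = 2 * g_bil \<mu> p * h_bil \<mu> p"
    unfolding hirota_D2_jet [OF has_jet_g_bil has_jet_g_bil] bilinear_WW [symmetric] g_bil_def
    by algebra
  show "hirota_D2 (g_bil \<mu>) (f_bil \<mu>) p
     = - 16 * complex_of_real (S \<mu> p) * (g_bil \<mu> p + h_bil \<mu> p)"
  proof -
    \<comment> \<open>Splits off the two identities for \<open>W\<close>. The terms with
      \<open>h\<close> then add up to \<open>h * (W * cnj W - f)\<close>, which is
      \<open>- 16 * S * h\<close>.\<close>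
    have "hirota_D2 (g_bil \<mu>) (f_bil \<mu>) p
        = W \<mu> p * (16 * f_bil \<mu> p * Wzw \<mu> p - 8 * (Wz \<mu> p * fw \<mu> p + Ww \<mu> p * fz \<mu> p)
            + 4 * W \<mu> p * fzw \<mu> p)
          - f_bil \<mu> p * (8 * (W \<mu> p * Wzw \<mu> p - Wz \<mu> p * Ww \<mu> p))"
      unfolding hirota_D2_jet [OF has_jet_g_bil has_jet_f_bil] g_bil_def by algebra
    also have "\<dots> = - 16 * complex_of_real (S \<mu> p) * (g_bil \<mu> p + h_bil \<mu> p)"
      unfolding bilinear_Wf bilinear_WW unfolding f_bil_eq g_bil_def by algebra
    finally show ?thesis .
  qed
qed

section \<open>The sine-Gordon equation\<close>

text \<open>The equation at one point, with \<open>s\<close> for the inverse square root of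
  \<open>f\<close>, \<open>V\<close> for \<open>cnj W\<close> and \<open>sz\<close>,
  \<open>sw\<close>, \<open>szw\<close> for the derivatives of \<open>s\<close>.\<close>

lemma csG2_from_bilinear:
  fixes W Wz Ww Wzw V S f fz fw fzw h s :: complex
  assumes WW: "8 * (W * Wzw - Wz * Ww) = h"
    and ff: "4 * (f * fzw - fz * fw) = 256 * S\<^sup>2"
    and Wf: "16 * f * Wzw - 8 * (Wz * fw + Ww * fz) + 4 * W * fzw = h * V - 16 * S * W"
    and f: "f = W * V + 16 * S" and s: "s\<^sup>2 * f = 1" and nz: "f + 16 * S \<noteq> 0"
  defines "sz \<equiv> - (1/2) * fz * s ^ 3" and "sw \<equiv> - (1/2) * fw * s ^ 3"
    and "szw \<equiv> - (1/2) * fzw * s ^ 3 + 3/4 * fz * fw * s ^ 5"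
  shows "4 * (Wzw * s + Wz * sw + Ww * sz + W * szw)
    + 4 * ((Wz * s + W * sz) * (Ww * s + W * sw)) * (V * s) / (2 - W * V * s\<^sup>2)
    + 1/2 * (W * s) * (1 - W * V * s\<^sup>2) * (2 - W * V * s\<^sup>2) = 0"
proof -
  let ?d = "f + 16 * S"
  have s0: "s \<noteq> 0" using s by auto
  \<comment> \<open>Replace the constants \<open>2\<close> and \<open>1\<close> by multiples of
    \<open>s^2 * f\<close>, and \<open>W * V\<close> by \<open>f - 16 * S\<close>.\<close>
  have d: "2 - W * V * s\<^sup>2 = ?d * s\<^sup>2" and e: "1 - W * V * s\<^sup>2 = 16 * S * s\<^sup>2"
    using s f by algebra+
  have quot: "x * (V * s) / (?d * s\<^sup>2) = x * V * (f * s) / ?d" for x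
    using s0 nz s by (simp add: divide_simps) algebra
  \<comment> \<open>Since \<open>s^2\<close> is the inverse of \<open>f\<close>, every odd power of
    \<open>s\<close> can be raised to \<open>s ^ 5\<close>, which becomes a common factor of all
    terms.\<close>
  have s1: "s = f\<^sup>2 * s ^ 5" and s3: "s ^ 3 = f * s ^ 5"
    using s by algebra+
  have A: "Wzw * s + Wz * sw + Ww * sz + W * szw
      = s ^ 5 * (Wzw * f\<^sup>2 - 1/2 * (Wz * fw + Ww * fz + W * fzw) * f + 3/4 * W * fz * fw)"
  proof -
    have "Wzw * s + Wz * sw + Ww * sz + W * szw =
        Wzw * s - 1/2 * (Wz * fw + Ww * fz + W * fzw) * s ^ 3 + 3/4 * W * fz * fw * s ^ 5"
      by (simp add: sw_def sz_def szw_def algebra_simps)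
    also have "\<dots> = Wzw * (f\<^sup>2 * s ^ 5) - 1/2 * (Wz * fw + Ww * fz + W * fzw) * (f * s ^ 5)
        + 3/4 * W * fz * fw * s ^ 5"
      using s1 s3 by simp
    finally show ?thesis by (simp add: algebra_simps)
  qed
  have B: "(Wz * s + W * sz) * (Ww * s + W * sw) * (f * s)
      = s ^ 5 * (Wz * Ww * f\<^sup>2 - 1/2 * W * (Wz * fw + Ww * fz) * f + 1/4 * W\<^sup>2 * fz * fw)"
  proof -
    have "(Wz * s + W * sz) * (Ww * s + W * sw) * (f * s) =
        Wz * Ww * f * s ^ 3 - 1/2 * W * (Wz * fw + Ww * fz) * f * s ^ 5
        + 1/4 * W\<^sup>2 * fz * fw * (s\<^sup>2 * f) * s ^ 5"
      by (simp add: sw_def sz_def algebra_simps eval_nat_numeral)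
    also have "\<dots> = Wz * Ww * f * (f * s ^ 5) - 1/2 * W * (Wz * fw + Ww * fz) * f * s ^ 5
        + 1/4 * W\<^sup>2 * fz * fw * s ^ 5"
      using s s3 by simp
    finally show ?thesis by (simp add: algebra_simps eval_nat_numeral)
  qed
  \<comment> \<open>This is the equation multiplied by \<open>?d\<close> and stripped of
    \<open>s ^ 5\<close>.\<close>
  have key: "?d * (4 * Wzw * f\<^sup>2 - 2 * (Wz * fw + Ww * fz + W * fzw) * f + 3 * W * fz * fw)
      + V * (4 * Wz * Ww * f\<^sup>2 - 2 * W * (Wz * fw + Ww * fz) * f + W\<^sup>2 * fz * fw)
      + 8 * W * S * ?d\<^sup>2 = 0" (is "?E = 0")
  proof -
    \<comment> \<open>The multipliers come from matching coefficients: \<open>Wzw\<close> fits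
      because \<open>2 * f - W * V = ?d\<close>, the terms with \<open>h\<close> cancel, and the
      rest sums to \<open>32 * W * S * ?d^2\<close>. The factor 4 keeps all coefficients
      integral.\<close>
    have "4 * ?E = 2 * f\<^sup>2 * (16 * f * Wzw - 8 * (Wz * fw + Ww * fz) + 4 * W * fzw - (h * V - 16 * S * W))
        - 2 * f\<^sup>2 * V * (8 * (W * Wzw - Wz * Ww) - h)
        - (3 * ?d * W + W\<^sup>2 * V) * (4 * (f * fzw - fz * fw) - 256 * S\<^sup>2)"
      unfolding f by algebra
    then have "4 * ?E = 0"
      unfolding WW ff Wf by (simp only: diff_self mult_zero_right)
    then show ?thesis
      by (simp only: mult_eq_0_iff numeral_neq_zero simp_thms)
  qed
  have cancel: "?d * (x + y / ?d + z) = ?d * x + y + ?d * z" for x y z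
    using nz by (simp add: distrib_left)
  have "?d * (4 * (Wzw * s + Wz * sw + Ww * sz + W * szw)
      + 4 * ((Wz * s + W * sz) * (Ww * s + W * sw)) * V * (f * s) / ?d
      + 1/2 * (W * s) * (16 * S * s\<^sup>2) * (?d * s\<^sup>2))
    = 4 * ?d * (Wzw * s + Wz * sw + Ww * sz + W * szw)
      + 4 * V * ((Wz * s + W * sz) * (Ww * s + W * sw) * (f * s)) + 8 * W * S * ?d\<^sup>2 * s ^ 5"
    unfolding cancel by algebra
  also have "\<dots> = s ^ 5 * ?E"
    unfolding A B by algebra
  also have "\<dots> = 0"
    unfolding key by (rule mult_zero_right)
  finally show ?thesis
    unfolding d e quot using nz by (simp only: mult_eq_0_iff simp_thms)
qed

lemma Psi_tilde_eq: "Psi_tilde \<mu> p = W \<mu> p * complex_of_real (inverse (sqrt (Q \<mu> p)))"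
  by (simp add: Psi_tilde_def divide_inverse)

lemma csG2_solution_Psi_tilde: "csG2_solution (Psi_tilde \<mu>)"
proof -
  define s where "s p = complex_of_real (inverse (sqrt (Q \<mu> p)))" for p
  have psi: "Psi_tilde \<mu> = (\<lambda>p. W \<mu> p * s p)"
    by (simp add: fun_eq_iff s_def Psi_tilde_eq)
  have jet_s: "has_jet s (\<lambda>p. - (1/2) * fz \<mu> p * s p ^ 3) (\<lambda>p. - (1/2) * fw \<mu> p * s p ^ 3)
           (\<lambda>p. - (1/2) * fzz \<mu> p * s p ^ 3 + 3/4 * fz \<mu> p * fz \<mu> p * s p ^ 5)
           (\<lambda>p. - (1/2) * fzw \<mu> p * s p ^ 3 + 3/4 * fz \<mu> p * fw \<mu> p * s p ^ 5)
           (\<lambda>p. - (1/2) * fww \<mu> p * s p ^ 3 + 3/4 * fw \<mu> p * fw \<mu> p * s p ^ 5)"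
    using has_jet_inverse_sqrt [OF has_jet_f_bil [of \<mu>] f_bil_def Q_pos] unfolding s_def .
  note jet_psi = has_jet_mult [OF has_jet_W [of \<mu>] jet_s, folded psi]
  have s2: "(s p)\<^sup>2 * f_bil \<mu> p = 1" for p
    using Q_pos [of \<mu> p]
    by (simp add: s_def f_bil_def power_inverse flip: of_real_power of_real_mult)
  have cnj_s: "cnj (s p) = s p" for p
    by (simp add: s_def)
  have psi_eq: "Psi_tilde \<mu> p = W \<mu> p * s p" for p
    by (simp add: psi)
  have cnj_psi: "cnj (Psi_tilde \<mu> p) = cnj (W \<mu> p) * s p" for p
    by (simp add: psi cnj_s)
  have norm: "complex_of_real ((cmod (Psi_tilde \<mu> p))\<^sup>2) = W \<mu> p * cnj (W \<mu> p) * (s p)\<^sup>2" for p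
    unfolding complex_norm_square psi by (simp add: cnj_s power2_eq_square)
  have nz: "f_bil \<mu> p + 16 * complex_of_real (S \<mu> p) \<noteq> 0" for p
  proof -
    have "Q \<mu> p + 16 * S \<mu> p \<noteq> 0"
      using Q_pos [of \<mu> p] S_pos [of \<mu> p] by simp
    then have "complex_of_real (Q \<mu> p + 16 * S \<mu> p) \<noteq> 0"
      by (simp only: of_real_eq_0_iff not_False_eq_True)
    then show ?thesis by (simp add: f_bil_def)
  qed
  show ?thesis
    unfolding csG2_solution_def
  proof (intro conjI allI)
    show "C2_on_plane (Psi_tilde \<mu>)"
      by (rule C2_on_plane_jet [OF jet_psi])
  next
    fix p
    \<comment> \<open>The denominator exceeds the numerator by \<open>16 * S\<close>, so the
      quotient is even below 1.\<close>
    have "(cmod (Psi_tilde \<mu> p))\<^sup>2 = (cmod (W \<mu> p))\<^sup>2 / Q \<mu> p"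
      using Q_pos [of \<mu> p] by (simp add: Psi_tilde_def norm_divide power_divide)
    also have "\<dots> < 2"
      using Q_pos [of \<mu> p] S_pos [of \<mu> p] by (simp add: divide_less_eq) (simp add: Q_def add_pos_nonneg)
    finally show "(cmod (Psi_tilde \<mu> p))\<^sup>2 \<noteq> 2" by simp
  next
    fix p
    show "laplacian (Psi_tilde \<mu>) p
          + grad_dot (Psi_tilde \<mu>) (Psi_tilde \<mu>) p * cnj (Psi_tilde \<mu> p)
            / (2 - complex_of_real ((cmod (Psi_tilde \<mu> p))\<^sup>2))
          + 1 / 2 * Psi_tilde \<mu> p * (1 - complex_of_real ((cmod (Psi_tilde \<mu> p))\<^sup>2))
              * (2 - complex_of_real ((cmod (Psi_tilde \<mu> p))\<^sup>2)) = 0"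
      using csG2_from_bilinear [OF bilinear_WW bilinear_ff bilinear_Wf f_bil_eq s2 nz, of p]
      unfolding laplacian_jet [OF jet_psi] grad_dot_self_jet [OF jet_psi] norm cnj_psi
      unfolding psi_eq .
  qed
qed

section \<open>Vortices\<close>

text \<open>Intermediate value theorem: at \<open>m / a\<close> the linear term \<open>r * a\<close>
  alone reaches \<open>m\<close>.\<close>

lemma obtain_cubic_root:
  fixes a m :: real
  assumes "0 < a" "0 < m"
  obtains r where "0 < r" "r * (r\<^sup>2 + a) = m"
proof -
  have "m = m / a * a" using assms by simp
  also have "\<dots> \<le> m / a * ((m / a)\<^sup>2 + a)"
    using assms by (intro mult_left_mono) auto
  finally have "m \<le> m / a * ((m / a)\<^sup>2 + a)" .
  moreover have "continuous_on {0..m / a} (\<lambda>r. r * (r\<^sup>2 + a))"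
    by (intro continuous_intros)
  ultimately obtain r where r: "r \<ge> 0" "r * (r\<^sup>2 + a) = m"
    using IVT' [of "\<lambda>r. r * (r\<^sup>2 + a)" 0 m "m / a"] assms by auto
  with assms have "r \<noteq> 0" by auto
  with r show ?thesis using that [of r] by simp
qed

lemma dist_zc: "dist p q = cmod (zc p - zc q)"
  by (simp add: dist_prod_def dist_real_def zc_def cmod_def)

lemma vortex_points_Psi_tilde: "vortex_points (Psi_tilde \<mu>) = {p. W \<mu> p = 0}"
  using Q_pos [of \<mu>] by (auto simp: vortex_points_def Psi_tilde_def less_le)

text \<open>Multiplication by \<open>z\<close> turns \<open>cnj z\<close> into the squared modulus,
  so the argument of \<open>z\<close> enters only through \<open>z ^ 3\<close>.\<close>

lemma W_eq_0_iff:
  "W \<mu> p = 0 \<longleftrightarrow>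
     zc p = 0 \<or> (complex_of_real ((cmod (zc p))\<^sup>2) + 24) * zc p ^ 3 = 2 * \<mu> * complex_of_real ((cmod (zc p))\<^sup>2)"
proof (cases "zc p = 0")
  case False
  have "zc p * W \<mu> p = (complex_of_real ((cmod (zc p))\<^sup>2) + 24) * zc p ^ 3
      - 2 * \<mu> * complex_of_real ((cmod (zc p))\<^sup>2)"
    unfolding W_poly complex_norm_square by algebra
  then have "zc p * W \<mu> p = 0 \<longleftrightarrow> (complex_of_real ((cmod (zc p))\<^sup>2) + 24) * zc p ^ 3
      = 2 * \<mu> * complex_of_real ((cmod (zc p))\<^sup>2)"
    by simp
  with False show ?thesis by simp
qed (simp add: W_def)

lemma of_real_square_add_24_neq_0: "complex_of_real (r\<^sup>2) + 24 \<noteq> 0"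
proof -
  have "r\<^sup>2 + 24 > 0" by (simp add: add_nonneg_pos)
  then have "complex_of_real (r\<^sup>2 + 24) \<noteq> 0"
    by (metis less_irrefl of_real_eq_0_iff)
  then show ?thesis by simp
qed

text \<open>Here the outer vortices have merged with the origin, and no nondegenerate triangle is
  left.\<close>

lemma vortex_points_zero_parameter: "vortex_points (Psi_tilde 0) = {0}"
proof -
  have "complex_of_real ((cmod z)\<^sup>2) + 24 \<noteq> 0" for z
    by (rule of_real_square_add_24_neq_0)
  then have "W 0 p = 0 \<longleftrightarrow> zc p = 0" for p
    unfolding W_eq_0_iff by auto
  then show ?thesis
    using zc_eq_iff [of _ 0] by (auto simp: vortex_points_Psi_tilde)
qed

text \<open>The difference of the two sides is \<open>r - t\<close> times a positive factor.\<close>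

lemma cubic_inj_nonneg:
  fixes a r t :: real
  assumes "0 < a" "0 \<le> r" "0 \<le> t" "r * (r\<^sup>2 + a) = t * (t\<^sup>2 + a)"
  shows "r = t"
proof -
  have "(r - t) * (r\<^sup>2 + r * t + t\<^sup>2 + a) = 0"
    using assms(4) by algebra
  moreover have "r\<^sup>2 + r * t + t\<^sup>2 + a > 0"
    using assms by (intro add_nonneg_pos add_nonneg_nonneg) auto
  ultimately show ?thesis by simp
qed

lemma W_zeros_cube_roots:
  assumes "\<mu> \<noteq> 0"
  obtains c where "c \<noteq> 0" "\<And>p. W \<mu> p = 0 \<longleftrightarrow> zc p = 0 \<or> zc p ^ 3 = c ^ 3"
proof -
  \<comment> \<open>The equation for \<open>r\<close> is the modulus of the zero condition in
    \<open>W_eq_0_iff\<close>, divided by the squared modulus of \<open>z\<close>.\<close>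
  obtain r where r: "0 < r" "r * (r\<^sup>2 + 24) = 2 * cmod \<mu>"
    by (rule obtain_cubic_root [of 24 "2 * cmod \<mu>"]) (use assms in auto)
  \<comment> \<open>In the zero condition the factors other than \<open>z ^ 3\<close> and
    \<open>\<mu>\<close> are positive, so \<open>z ^ 3\<close> must have the argument of
    \<open>\<mu>\<close>.\<close>
  define c where "c = complex_of_real r * cis (Arg \<mu> / 3)"
  have r24: "complex_of_real r ^ 2 + 24 \<noteq> 0"
    using of_real_square_add_24_neq_0 [of r] by simp
  have norm_c: "cmod c = r"
    using r(1) by (simp add: c_def norm_mult)
  have mu: "\<mu> = complex_of_real (cmod \<mu>) * cis (Arg \<mu>)"
    using rcis_cmod_Arg [of \<mu>] by (simp add: rcis_def)
  have c3: "c ^ 3 = complex_of_real r ^ 3 * cis (Arg \<mu>)"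
    unfolding c_def power_mult_distrib Complex.DeMoivre by simp
  have rc: "complex_of_real r * (complex_of_real r ^ 2 + 24) = 2 * complex_of_real (cmod \<mu>)"
    using arg_cong [OF r(2), of complex_of_real] by simp
  have c_eq: "(complex_of_real r ^ 2 + 24) * c ^ 3 = 2 * \<mu> * complex_of_real r ^ 2"
  proof -
    have "(complex_of_real r ^ 2 + 24) * c ^ 3
        = complex_of_real r ^ 2 * (complex_of_real r * (complex_of_real r ^ 2 + 24)) * cis (Arg \<mu>)"
      unfolding c3 by algebra
    also have "\<dots> = 2 * (complex_of_real (cmod \<mu>) * cis (Arg \<mu>)) * complex_of_real r ^ 2"
      unfolding rc by algebra
    finally show ?thesis unfolding mu [symmetric] .
  qed
  have zeros: "W \<mu> p = 0 \<longleftrightarrow> zc p = 0 \<or> zc p ^ 3 = c ^ 3" for p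
  proof -
    let ?z = "zc p"
    have "(complex_of_real ((cmod ?z)\<^sup>2) + 24) * ?z ^ 3 = 2 * \<mu> * complex_of_real ((cmod ?z)\<^sup>2)
        \<longleftrightarrow> ?z ^ 3 = c ^ 3" (is "?L \<longleftrightarrow> ?R") if "?z \<noteq> 0"
    proof -
      \<comment> \<open>With this modulus the condition has the same coefficients as
        \<open>c_eq\<close>. The next two claims show that either side forces the modulus to be
        \<open>r\<close>.\<close>
      have "?L \<longleftrightarrow> ?R" if "cmod ?z = r"
        using r24 unfolding that of_real_power c_eq [symmetric]
        by (simp only: mult_cancel_left simp_thms)
      moreover have "cmod ?z = r" if ?R
      proof -
        have "cmod ?z ^ 3 = r ^ 3"
          using arg_cong [OF that, of cmod] by (simp add: norm_power norm_c)
        then show ?thesis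
          using r(1) by (simp add: power_eq_iff_eq_base)
      qed
      moreover have "cmod ?z = r" if ?L
      proof -
        have "cmod (complex_of_real ((cmod ?z)\<^sup>2 + 24)) * cmod ?z ^ 3 = 2 * cmod \<mu> * (cmod ?z)\<^sup>2"
          using arg_cong [OF that, of cmod] by (simp add: norm_mult norm_power)
        then have "((cmod ?z)\<^sup>2 + 24) * cmod ?z ^ 3 = 2 * cmod \<mu> * (cmod ?z)\<^sup>2"
          unfolding norm_of_real by (simp add: abs_of_nonneg)
        then have "(cmod ?z)\<^sup>2 * (cmod ?z * ((cmod ?z)\<^sup>2 + 24)) = (cmod ?z)\<^sup>2 * (r * (r\<^sup>2 + 24))"
          unfolding r(2) by (simp add: power2_eq_square power3_eq_cube mult_ac)
        then have "cmod ?z * ((cmod ?z)\<^sup>2 + 24) = r * (r\<^sup>2 + 24)"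
          using \<open>?z \<noteq> 0\<close> by simp
        then show ?thesis
          by (rule cubic_inj_nonneg [of 24, rotated 3]) (use r(1) in simp_all)
      qed
      ultimately show ?thesis by argo
    qed
    then show ?thesis
      unfolding W_eq_0_iff by argo
  qed
  have "c \<noteq> 0"
    using r(1) norm_c by auto
  then show ?thesis
    using zeros by (rule that)
qed

lemma one_three_configuration_cube_roots:
  assumes "c \<noteq> 0" and vort: "\<And>p. \<psi> p = 0 \<longleftrightarrow> zc p = 0 \<or> zc p ^ 3 = c ^ 3"
  shows "one_three_configuration \<psi>"
proof -
  \<comment> \<open>A primitive cube root of unity.\<close>
  define w where "w = Complex (- 1 / 2) (sqrt 3 / 2)"
  have w: "w\<^sup>2 + w + 1 = 0"
    by (simp add: w_def complex_eq_iff power2_eq_square)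
  then have w3: "w ^ 3 = 1" by algebra
  have "w \<noteq> 1" using w by auto
  have norm_w: "cmod w = 1"
    using power_eq_1_iff [OF w3] by simp
  define pt where "pt z = (Re z, Im z)" for z
  have zc_pt [simp]: "zc (pt z) = z" for z
    by (simp add: pt_def zc_def)
  have eq_pt: "p = pt z \<longleftrightarrow> zc p = z" for p z
    by (metis zc_pt zc_eq_iff)
  have roots: "z ^ 3 = c ^ 3 \<longleftrightarrow> z = c \<or> z = c * w \<or> z = c * w\<^sup>2" for z
  proof -
    have "z ^ 3 - c ^ 3 = (z - c) * (z - c * w) * (z - c * w\<^sup>2)"
      using w by algebra
    then show ?thesis
      by (metis mult_eq_0_iff right_minus_eq)
  qed
  \<comment> \<open>Multiplication by \<open>w\<close>, of modulus 1, carries each side of the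
    triangle to the next, hence equal lengths.\<close>
  have "c * w - c * w\<^sup>2 = w * (c - c * w)"
    by (simp add: power2_eq_square algebra_simps)
  moreover have "c * w\<^sup>2 - c = w\<^sup>2 * (c - c * w)"
    using w3 by algebra
  ultimately have "dist (pt c) (pt (c * w)) = dist (pt (c * w)) (pt (c * w\<^sup>2))"
    "dist (pt (c * w)) (pt (c * w\<^sup>2)) = dist (pt (c * w\<^sup>2)) (pt c)"
    by (simp_all add: dist_zc norm_mult norm_power norm_w)
  moreover have "pt c \<noteq> pt (c * w)"
    using assms(1) \<open>w \<noteq> 1\<close> by (simp add: eq_pt)
  moreover have "pt c + pt (c * w) + pt (c * w\<^sup>2) = 0"
  proof -
    have "zc (pt c + pt (c * w) + pt (c * w\<^sup>2)) = c * (w\<^sup>2 + w + 1)"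
      by (simp add: zc_add algebra_simps)
    then show ?thesis
      using w zc_eq_iff [of _ 0] by simp
  qed
  ultimately have "centered_equilateral_triangle (pt c) (pt (c * w)) (pt (c * w\<^sup>2))"
    by (simp add: centered_equilateral_triangle_def)
  moreover have "vortex_points \<psi> = {0, pt c, pt (c * w), pt (c * w\<^sup>2)}"
    using zc_eq_iff [of _ 0] by (auto simp: vortex_points_def vort roots eq_pt)
  ultimately show ?thesis
    unfolding one_three_configuration_def by blast
qed

lemma one_three_configuration_Psi_tilde:
  assumes "\<mu> \<noteq> 0"
  shows "one_three_configuration (Psi_tilde \<mu>)"
proof -
  obtain c where "c \<noteq> 0" "\<And>p. W \<mu> p = 0 \<longleftrightarrow> zc p = 0 \<or> zc p ^ 3 = c ^ 3"
    using W_zeros_cube_roots [OF assms] by blast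
  moreover have "Psi_tilde \<mu> p = 0 \<longleftrightarrow> W \<mu> p = 0" for p
    using vortex_points_Psi_tilde [of \<mu>] by (auto simp: vortex_points_def)
  ultimately show ?thesis
    by (intro one_three_configuration_cube_roots) auto
qed

section \<open>The real one-parameter family\<close>

text \<open>Of the terms of \<open>N1\<close> and \<open>N2\<close> that contain
  \<open>\<alpha>\<close>, those of degree two and three in \<open>x\<close>, \<open>y\<close>
  cancel. The linear ones have coefficients \<open>\<alpha> * (24 + 2 * \<alpha>\<^sup>2)\<close> up
  to sign, which is twice \<open>\<alpha> * (\<alpha>\<^sup>2 + 12)\<close> and explains the value
  of \<open>\<mu>\<close>.\<close>

lemma W_real_family:
  assumes "\<mu> = complex_of_real (\<alpha> * (\<alpha>\<^sup>2 + 12)) * (1 - \<i>)"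
  shows "W \<mu> p = complex_of_real (N1 \<alpha> p) + \<i> * complex_of_real (N2 \<alpha> p)"
proof (cases p)
  case (Pair x y)
  have mu: "Re \<mu> = \<alpha> * (\<alpha>\<^sup>2 + 12)" "Im \<mu> = - (\<alpha> * (\<alpha>\<^sup>2 + 12))"
    by (simp_all add: assms)
  have "Re (W \<mu> p) = (x\<^sup>2 + y\<^sup>2 + 24) * (x\<^sup>2 - y\<^sup>2) - 2 * (Re \<mu> * x + Im \<mu> * y)"
    "Im (W \<mu> p) = (x\<^sup>2 + y\<^sup>2 + 24) * (2 * x * y) - 2 * (Im \<mu> * x - Re \<mu> * y)"
    unfolding Pair W_def cmod_power2 by (simp_all add: zc_def power2_eq_square)
  then have "Re (W \<mu> p) = N1 \<alpha> p" "Im (W \<mu> p) = N2 \<alpha> p"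
    unfolding mu Pair N1_def N2_def R_al_def I_al_def prod.case by algebra+
  then show ?thesis
    by (simp add: complex_eq_iff)
qed

lemma Q_real_family:
  assumes "\<mu> = complex_of_real (\<alpha> * (\<alpha>\<^sup>2 + 12)) * (1 - \<i>)"
  shows "Q \<mu> p = P_al \<alpha> p"
proof (cases p)
  case (Pair x y)
  define m where "m = \<alpha> * (\<alpha>\<^sup>2 + 12)"
  have mu: "Re \<mu> = m" "Im \<mu> = - m"
    by (simp_all add: assms m_def)
  \<comment> \<open>Brings the fourth power into the reach of \<open>cmod_power2\<close>.\<close>
  have norm4: "cmod z ^ 4 = ((cmod z)\<^sup>2)\<^sup>2" for z
    by simp
  have "Re (T \<mu> p) = x ^ 3 - 3 * x * y\<^sup>2 + m" "Im (T \<mu> p) = 3 * x\<^sup>2 * y - y ^ 3 - m"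
    by (simp_all add: Pair T_def zc_def mu power2_eq_square power3_eq_cube algebra_simps)
  then have "S \<mu> p = (x ^ 3 - 3 * x * y\<^sup>2 + m)\<^sup>2 + (3 * x\<^sup>2 * y - y ^ 3 - m)\<^sup>2
      + 36 * (x\<^sup>2 + y\<^sup>2)\<^sup>2 + 576 * (x\<^sup>2 + y\<^sup>2) + 2304"
    unfolding S_def norm4 cmod_power2 by (simp add: Pair zc_def)
  moreover have "(cmod (W \<mu> p))\<^sup>2 = (N1 \<alpha> p)\<^sup>2 + (N2 \<alpha> p)\<^sup>2"
    unfolding W_real_family [OF assms] cmod_power2 by simp
  ultimately show ?thesis
    unfolding Q_def Pair N1_def N2_def R_al_def I_al_def P_al_def prod.case Let_def m_def by algebra
qed

theorem mainTheorem3: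
  fixes \<mu> :: complex
  shows
    "(\<forall>p. 0 < Q \<mu> p \<and>
        (Psi_tilde \<mu> p)\<^sup>2 = g_bil \<mu> p / f_bil \<mu> p \<and>
        hirota_D2 (f_bil \<mu>) (f_bil \<mu>) p = 512 * (complex_of_real (S \<mu> p))\<^sup>2 \<and>
        512 * (complex_of_real (S \<mu> p))\<^sup>2
          = 2 * (f_bil \<mu> p - complex_of_real (cmod (g_bil \<mu> p)))\<^sup>2 \<and>
        hirota_D2 (g_bil \<mu>) (g_bil \<mu>) p = 2 * g_bil \<mu> p * h_bil \<mu> p \<and>
        hirota_D2 (g_bil \<mu>) (f_bil \<mu>) p
          = - 16 * complex_of_real (S \<mu> p) * (g_bil \<mu> p + h_bil \<mu> p))
     \<and> (csG2_solution (Psi_tilde \<mu>) \<and>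
        (\<mu> \<noteq> 0 \<longrightarrow> one_three_configuration (Psi_tilde \<mu>)) \<and>
        (\<mu> = 0 \<longrightarrow> vortex_points (Psi_tilde \<mu>) = {0}))
     \<and> (\<forall>\<alpha>::real. \<alpha> \<ge> 0 \<longrightarrow>
          \<mu> = complex_of_real (\<alpha> * (\<alpha>\<^sup>2 + 12)) * (1 - \<i>) \<longrightarrow>
          (\<forall>p. W \<mu> p = complex_of_real (N1 \<alpha> p) + \<i> * complex_of_real (N2 \<alpha> p)) \<and>
          (\<forall>p. Q \<mu> p = P_al \<alpha> p) \<and>
          Psi_tilde \<mu> = Psi_al \<alpha>)"
  using Q_pos [of \<mu>] bilinear_identities [of \<mu>] csG2_solution_Psi_tilde [of \<mu>]
    one_three_configuration_Psi_tilde [of \<mu>] vortex_points_zero_parameter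
    W_real_family [of \<mu>] Q_real_family [of \<mu>]
  by (auto simp: fun_eq_iff Psi_tilde_def Psi_al_def)

end
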